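(* Let $\mathscr{A}$ be a unital $C^*$-algebra with identity $e$, let $\mathscr{X}$ be a Hilbert $\mathscr{A}$-module and let $x, y\in\mathscr{X}$ be such that $|y|^2 = e$. The following statements are equivalent: (i) $x\parallel y$. (ii) $|x|^2-2\|x\|\,\mathrm{Re}(\langle x, \lambda y\rangle) + \|x\|^2e$ is non-invertible in $\mathscr{A}$ for some $\lambda\in\mathbb{T}$.
   Context: A Hilbert $\mathscr{A}$-module is a complex linear space $\mathscr{X}$ that is a right $\mathscr{A}$-module (with compatible scalar multiplication) with an $\mathscr{A}$-valued inner product $\langle\cdot,\cdot\rangle$ that is linear in the second variable, satisfies $\langle x, ya\rangle=\langle x,y\rangle a$, $\langle x,y\rangle^*=\langle y,x\rangle$, $\langle x,x\rangle\ge 0$ with $\langle x,x\rangle=0$ iff $x=0$, and such that $\mathscr{X}$ is complete for the norm $\|x\|=\|\langle x,x\rangle\|^{1/2}$. For $x\in\mathscr{X}$, $|x|=\langle x,x\rangle^{1/2}$, so $|x|^2=\langle x,x\rangle$. For $a\in\mathscr{A}$, $\mathrm{Re}(a)=\frac{a+a^*}{2}$. In a normed space, $x\parallel y$ (norm-parallel) means that $\|x+\lambda y\|=\|x\|+\|y\|$ for some $\lambda\in\mathbb{T}=\{\alpha\in\mathbb{C}:|\alpha|=1\}$. *)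

theory Defs
  imports "HOL-Analysis.Analysis"
begin

class complex_vector = real_vector +
  fixes scaleC :: "complex \<Rightarrow> 'a \<Rightarrow> 'a" (infixr "*\<^sub>C" 75)
  assumes scaleC_add_right: "\<alpha> *\<^sub>C (x + y) = \<alpha> *\<^sub>C x + \<alpha> *\<^sub>C y"
    and scaleC_add_left: "(\<alpha> + \<beta>) *\<^sub>C x = \<alpha> *\<^sub>C x + \<beta> *\<^sub>C x"
    and scaleC_scaleC: "\<alpha> *\<^sub>C \<beta> *\<^sub>C x = (\<alpha> * \<beta>) *\<^sub>C x"
    and scaleC_one: "1 *\<^sub>C x = x"
    and scaleR_scaleC: "r *\<^sub>R x = complex_of_real r *\<^sub>C x"

class complex_normed_vector = complex_vector + real_normed_vector +
  assumes norm_scaleC: "norm (\<alpha> *\<^sub>C x) = cmod \<alpha> * norm x"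

class complex_banach = complex_normed_vector + complete_space

text \<open>The superclass \<^class>\<open>real_normed_algebra_1\<close> makes the norm submultiplicative with
  \<open>norm 1 = 1\<close>; in particular the algebra is not the zero algebra.\<close>

class unital_cstar_algebra = complex_banach + real_normed_algebra_1 +
  fixes adj :: "'a \<Rightarrow> 'a"
  assumes mult_scaleC_left: "(\<alpha> *\<^sub>C a) * b = \<alpha> *\<^sub>C (a * b)"
    and mult_scaleC_right: "a * (\<alpha> *\<^sub>C b) = \<alpha> *\<^sub>C (a * b)"
    and adj_add: "adj (a + b) = adj a + adj b"
    and adj_scaleC: "adj (\<alpha> *\<^sub>C a) = cnj \<alpha> *\<^sub>C adj a"
    and adj_mult: "adj (a * b) = adj b * adj a"
    and adj_adj: "adj (adj a) = a"
    and cstar_identity: "norm (adj a * a) = (norm a)\<^sup>2"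

definition invertible_element :: "'a::ring_1 \<Rightarrow> bool" where
  "invertible_element a \<longleftrightarrow> (\<exists>b. a * b = 1 \<and> b * a = 1)"

definition spectrum :: "'a::unital_cstar_algebra \<Rightarrow> complex set" where
  "spectrum a = {\<mu>. \<not> invertible_element (a - \<mu> *\<^sub>C 1)}"

definition positive_element :: "'a::unital_cstar_algebra \<Rightarrow> bool" where
  "positive_element a \<longleftrightarrow> adj a = a \<and> spectrum a \<subseteq> complex_of_real ` {0..}"

definition real_part :: "'a::unital_cstar_algebra \<Rightarrow> 'a" where
  "real_part a = (1 / 2) *\<^sub>C (a + adj a)"

text \<open>A positive element of a \<open>C\<^sup>*\<close>-algebra has exactly one positive square root, so the
  choice operator does not choose among several candidates.\<close>

definition positive_sqrt :: "'a::unital_cstar_algebra \<Rightarrow> 'a" where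
  "positive_sqrt a = (SOME b. positive_element b \<and> b\<^sup>2 = a)"

text \<open>Right Hilbert modules: \<open>act x a\<close> is \<open>x a\<close> and \<open>ip x y\<close> is the inner product, linear in
  \<open>y\<close>. The norm of the carrier type is required to be the one induced by \<open>ip\<close>, so completeness
  for that norm is the type class constraint \<^class>\<open>complex_banach\<close>.\<close>

locale hilbert_module =
  fixes act :: "'x::complex_banach \<Rightarrow> 'a::unital_cstar_algebra \<Rightarrow> 'x"
    and ip :: "'x \<Rightarrow> 'x \<Rightarrow> 'a"
  assumes act_add_left: "act (x + y) a = act x a + act y a"
    and act_add_right: "act x (a + b) = act x a + act x b"
    and act_mult: "act x (a * b) = act (act x a) b"
    and act_one: "act x 1 = x"
    and act_scaleC_left: "act (\<alpha> *\<^sub>C x) a = \<alpha> *\<^sub>C act x a"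
    and act_scaleC_right: "act x (\<alpha> *\<^sub>C a) = \<alpha> *\<^sub>C act x a"
    and ip_add_right: "ip x (y + z) = ip x y + ip x z"
    and ip_scaleC_right: "ip x (\<alpha> *\<^sub>C y) = \<alpha> *\<^sub>C ip x y"
    and ip_act_right: "ip x (act y a) = ip x y * a"
    and adj_ip: "adj (ip x y) = ip y x"
    and ip_self_positive: "positive_element (ip x x)"
    and ip_self_eq_0_iff: "ip x x = 0 \<longleftrightarrow> x = 0"
    and norm_eq_sqrt_ip: "norm x = sqrt (norm (ip x x))"

definition module_abs :: "('x \<Rightarrow> 'x \<Rightarrow> 'a::unital_cstar_algebra) \<Rightarrow> 'x \<Rightarrow> 'a" where
  "module_abs ip x = positive_sqrt (ip x x)"

definition norm_parallel :: "'x::complex_normed_vector \<Rightarrow> 'x \<Rightarrow> bool" (infix "\<parallel>" 50) where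
  "x \<parallel> y \<longleftrightarrow> (\<exists>\<mu>. cmod \<mu> = 1 \<and> norm (x + \<mu> *\<^sub>C y) = norm x + norm y)"

end

theory Submission
  imports Defs
begin

text \<open>Write \<open>v = \<mu> y\<close>, so that \<open>\<langle>v, v\<rangle> = 1\<close> and \<open>\<parallel>v\<parallel> = \<parallel>y\<parallel> = 1\<close>, and \<open>r = \<parallel>x\<parallel>\<close>. The element in (ii) is
  \<open>b = \<langle>z, z\<rangle>\<close> for \<open>z = x - r v\<close>. Hence it has to be shown, for each fixed
  \<open>\<mu>\<close>, that \<open>\<parallel>x + v\<parallel> = r + 1\<close> iff \<open>b\<close> is not invertible. States would give this at once, as
  equality in the Cauchy-Schwarz inequality; the proof below replaces them by two estimates.

  If \<open>\<parallel>x + v\<parallel> = r + 1 - \<delta>\<close> with \<open>\<delta> > 0\<close>, then \<open>(r + 1) v c = (x + v) c - z c\<close> and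
  \<open>\<parallel>v c\<parallel> = \<parallel>c\<parallel>\<close> give \<open>\<parallel>z c\<parallel> \<ge> \<delta> \<parallel>c\<parallel>\<close> for every \<open>c\<close> in the algebra, so left multiplication by \<open>b\<close>
  is bounded below. For a self-adjoint element this forces invertibility
  (\<open>self_adjoint_bounded_below_invertible\<close>), because its spectrum is real.

  If \<open>\<parallel>x + v\<parallel> = r + 1\<close>, put \<open>a = \<langle>x + v, x + v\<rangle>\<close>; its norm is \<open>(r + 1)\<^sup>2\<close>, and, \<open>a\<close> being positive,
  this number lies in its spectrum. The identity
  \<open>r ((r + 1)\<^sup>2 - a) = b + (r + 1) (r\<^sup>2 - \<langle>x, x\<rangle>)\<close> writes a non-invertible element as \<open>b\<close> plus a
  positive element. If \<open>b\<close> were invertible, the right-hand side would be closer to a large multiple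
  of \<open>1\<close> than that multiple is to \<open>0\<close>, hence invertible.

  Both directions rest on the fact that the spectrum of a self-adjoint element \<open>a\<close> is real and contains
  \<open>\<parallel>a\<parallel>\<close> or \<open>- \<parallel>a\<parallel>\<close>. Its second half is proved without complex function theory, in
  \<open>norm_power_of_two_lt_1\<close>. It also yields positive square roots
  (\<open>positive_square_root_exists\<close>), without which \<open>|x|\<^sup>2 = \<langle>x, x\<rangle>\<close> would not be known.\<close>

section \<open>Scalars and the involution\<close>

subclass (in unital_cstar_algebra) banach ..

lemma scaleC_zero_left [simp]: "0 *\<^sub>C (x::'a::complex_vector) = 0"
  using scaleR_scaleC [of 0 x] by simp

lemma scaleC_zero_right [simp]: "c *\<^sub>C (0::'a::complex_vector) = 0"
  using scaleC_add_right [of c 0 "0::'a"] by simp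

lemma scaleC_minus_right: "c *\<^sub>C (- (x::'a::complex_vector)) = - (c *\<^sub>C x)"
  using scaleC_add_right [of c x "- x"] by (simp add: minus_unique)

lemma scaleC_minus_left: "(- c) *\<^sub>C (x::'a::complex_vector) = - (c *\<^sub>C x)"
  using scaleC_add_left [of c "- c" x] by (simp add: minus_unique)

lemma scaleC_diff_right: "c *\<^sub>C (x - (y::'a::complex_vector)) = c *\<^sub>C x - c *\<^sub>C y"
  using scaleC_add_right [of c x "- y"] by (simp add: scaleC_minus_right)

lemma scaleC_diff_left: "(c - d) *\<^sub>C (x::'a::complex_vector) = c *\<^sub>C x - d *\<^sub>C x"
  using scaleC_add_left [of c "- d" x] by (simp add: scaleC_minus_left)

lemma adj_zero [simp]: "adj (0::'a::unital_cstar_algebra) = 0"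
  using adj_add [of 0 "0::'a"] by simp

lemma adj_minus: "adj (- (a::'a::unital_cstar_algebra)) = - adj a"
  using adj_add [of a "- a"] by (simp add: minus_unique)

lemma adj_diff: "adj (a - (b::'a::unital_cstar_algebra)) = adj a - adj b"
  using adj_add [of a "- b"] by (simp add: adj_minus)

lemma adj_scaleR: "adj (r *\<^sub>R (a::'a::unital_cstar_algebra)) = r *\<^sub>R adj a"
  by (simp add: scaleR_scaleC adj_scaleC)

lemma adj_one [simp]: "adj (1::'a::unital_cstar_algebra) = 1"
  by (metis adj_adj adj_mult mult.right_neutral)

lemma norm_adj [simp]: "norm (adj (a::'a::unital_cstar_algebra)) = norm a"
proof -
  have le: "norm b \<le> norm (adj b)" for b :: 'a
  proof (cases "b = 0")
    case False
    have "norm b * norm b \<le> norm (adj b) * norm b"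
      using norm_mult_ineq [of "adj b" b] by (simp add: cstar_identity power2_eq_square)
    with False show ?thesis by simp
  qed simp
  from le [of a] le [of "adj a"] show ?thesis by (simp add: adj_adj)
qed

lemma norm_square_self_adjoint:
  "adj a = a \<Longrightarrow> norm (a * a) = (norm (a::'a::unital_cstar_algebra))\<^sup>2"
  using cstar_identity [of a] by simp

section \<open>Invertibility and real spectrum\<close>

text \<open>The inverse is the geometric series in \<open>a\<close>.\<close>

lemma invertible_one_minus:
  fixes a :: "'a::unital_cstar_algebra"
  assumes "norm a < 1"
  shows "invertible_element (1 - a)"
proof -
  have sm: "summable (\<lambda>n. a ^ n)"
    using assms by (intro summable_comparison_test' [OF summable_geometric [of "norm a"]])
      (auto simp: norm_power_ineq)
  define S where "S = (\<Sum>n. a ^ n)"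
  have "(\<Sum>n. a ^ Suc n) = S - 1"
    using suminf_split_head [OF sm] by (simp add: S_def)
  moreover have "(\<Sum>n. a ^ Suc n) = a * S"
    using suminf_mult [OF sm, of a] by (simp add: S_def)
  moreover have "(\<Sum>n. a ^ Suc n) = S * a"
    using suminf_mult2 [OF sm, of a] by (simp add: S_def power_commutes)
  ultimately show ?thesis
    unfolding invertible_element_def by (intro exI [of _ S]) (simp add: algebra_simps)
qed

lemma invertible_scaleC_iff:
  fixes a :: "'a::unital_cstar_algebra"
  assumes "c \<noteq> 0"
  shows "invertible_element (c *\<^sub>C a) \<longleftrightarrow> invertible_element a"
proof -
  have *: "invertible_element (d *\<^sub>C b)" if "d \<noteq> 0" "invertible_element b" for d and b :: 'a
  proof -
    from that obtain b' where "b * b' = 1" "b' * b = 1" by (auto simp: invertible_element_def)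
    with that(1) show ?thesis unfolding invertible_element_def
      by (intro exI [of _ "inverse d *\<^sub>C b'"])
        (simp add: mult_scaleC_left mult_scaleC_right scaleC_scaleC scaleC_one)
  qed
  show ?thesis
    using * [of c a] * [of "inverse c" "c *\<^sub>C a"] assms
    by (auto simp: scaleC_scaleC scaleC_one)
qed

lemma invertible_minus_iff:
  "invertible_element (- a) \<longleftrightarrow> invertible_element (a::'a::unital_cstar_algebra)"
  using invertible_scaleC_iff [of "- 1" a] by (simp add: scaleC_minus_left scaleC_one)

lemma invertible_scaleR_iff:
  "r \<noteq> 0 \<Longrightarrow> invertible_element (r *\<^sub>R a) \<longleftrightarrow> invertible_element (a::'a::unital_cstar_algebra)"
  using invertible_scaleC_iff [of "complex_of_real r" a] by (simp add: scaleR_scaleC)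

text \<open>Dividing by \<open>c\<close> reduces this to the geometric series.\<close>

lemma norm_less_imp_invertible:
  fixes a :: "'a::unital_cstar_algebra"
  assumes "norm (c *\<^sub>C 1 - a) < cmod c"
  shows "invertible_element a"
proof -
  have c: "c \<noteq> 0" using assms by auto
  have "norm (1 - inverse c *\<^sub>C a) = norm (inverse c *\<^sub>C (c *\<^sub>C 1 - a))"
    using c by (simp add: scaleC_diff_right scaleC_scaleC scaleC_one)
  also have "\<dots> < 1" using assms c by (simp add: norm_scaleC norm_inverse) (simp add: field_simps)
  finally have "invertible_element (1 - (1 - inverse c *\<^sub>C a))" by (rule invertible_one_minus)
  with c show ?thesis by (simp add: invertible_scaleC_iff)
qed

lemma spectrum_norm_le:
  fixes a :: "'a::unital_cstar_algebra"
  assumes "\<mu> \<in> spectrum a"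
  shows "cmod \<mu> \<le> norm a"
proof (rule ccontr)
  assume "\<not> ?thesis"
  then have "norm (- \<mu> *\<^sub>C 1 - (a - \<mu> *\<^sub>C 1)) < cmod (- \<mu>)"
    by (simp add: scaleC_minus_left)
  from norm_less_imp_invertible [OF this] assms show False by (simp add: spectrum_def)
qed

text \<open>Shifting \<open>a\<close> by \<open>\<i> t\<close> moves \<open>\<mu>\<close> to \<open>\<mu> + \<i> t\<close>, whose squared modulus contains the term
  \<open>2 t Im \<mu>\<close>, linear in \<open>t\<close>. By the \<open>C\<^sup>*\<close>-identity the squared norm of the shifted element is at most
  \<open>\<parallel>a\<parallel>\<^sup>2 + t\<^sup>2\<close>, without a linear term. For suitable \<open>t\<close> the two contradict each other unless
  \<open>Im \<mu> = 0\<close>.\<close>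

lemma self_adjoint_spectrum_real:
  fixes a :: "'a::unital_cstar_algebra"
  assumes a: "adj a = a" and \<mu>: "\<mu> \<in> spectrum a"
  shows "Im \<mu> = 0"
proof (rule ccontr)
  assume nz: "Im \<mu> \<noteq> 0"
  have bound: "(cmod \<mu>)\<^sup>2 + 2 * Im \<mu> * t \<le> (norm a)\<^sup>2" for t :: real
  proof -
    define b where "b = a + (\<i> * t) *\<^sub>C 1"
    have "\<mu> + \<i> * t \<in> spectrum b"
      using \<mu> by (simp add: spectrum_def b_def scaleC_add_left)
    then have "(cmod (\<mu> + \<i> * t))\<^sup>2 \<le> (norm b)\<^sup>2"
      by (intro power_mono spectrum_norm_le) auto
    moreover have "adj b * b = a * a + (t\<^sup>2) *\<^sub>R 1"
      by (simp add: b_def adj_add adj_scaleC a algebra_simps mult_scaleC_left mult_scaleC_right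
          scaleC_diff_right scaleC_scaleC scaleC_minus_left scaleR_scaleC power2_eq_square)
    then have "(norm b)\<^sup>2 = norm (a * a + (t\<^sup>2) *\<^sub>R 1)"
      by (simp flip: cstar_identity)
    moreover have "norm (a * a + (t\<^sup>2) *\<^sub>R 1) \<le> (norm a)\<^sup>2 + t\<^sup>2"
      by (rule order_trans [OF norm_triangle_ineq]) (simp add: norm_square_self_adjoint a)
    ultimately show ?thesis
      by (simp add: cmod_power2) (simp add: power2_eq_square algebra_simps)
  qed
  \<comment> \<open>This \<open>t\<close> makes the linear term equal to \<open>\<parallel>a\<parallel>\<^sup>2 + 1\<close>.\<close>
  from bound [of "((norm a)\<^sup>2 + 1) / (2 * Im \<mu>)"] nz
  have "(cmod \<mu>)\<^sup>2 + ((norm a)\<^sup>2 + 1) \<le> (norm a)\<^sup>2" by simp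
  then show False using zero_le_power2 [of "cmod \<mu>"] by linarith
qed

text \<open>Since the spectrum is real, \<open>u = a - \<i> t\<close> has an inverse \<open>v\<close> for real \<open>t \<noteq> 0\<close>, and the lower bound
  on \<open>a\<close> controls \<open>\<parallel>v\<parallel>\<close> uniformly in small \<open>t\<close>. Hence \<open>a = (1 + \<i> t v) u\<close> is a product of \<open>u\<close> with
  an element near \<open>1\<close>.\<close>

lemma self_adjoint_bounded_below_invertible:
  fixes a :: "'a::unital_cstar_algebra"
  assumes a: "adj a = a" and "\<epsilon> > 0" and below: "\<And>c. \<epsilon> * norm c \<le> norm (a * c)"
  shows "invertible_element a"
proof -
  \<comment> \<open>Any \<open>t < \<epsilon> / 2\<close> would do: it makes \<open>t \<parallel>v\<parallel> \<le> t / (\<epsilon> - t)\<close> less than \<open>1\<close>.\<close>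
  define t where "t = \<epsilon> / 3"
  have t: "t > 0" using assms by (simp add: t_def)
  define u where "u = a - (\<i> * t) *\<^sub>C 1"
  have "\<i> * t \<notin> spectrum a"
    using self_adjoint_spectrum_real [OF a, of "\<i> * t"] t by auto
  then obtain v where v: "u * v = 1" "v * u = 1"
    by (auto simp: spectrum_def invertible_element_def u_def)
  have "3 * t * norm v \<le> norm (a * v)" using below [of v] by (simp add: t_def)
  also have "a * v = 1 + (\<i> * t) *\<^sub>C v"
    using v(1) by (simp add: u_def algebra_simps mult_scaleC_left)
  also have "norm \<dots> \<le> 1 + t * norm v"
    by (rule order_trans [OF norm_triangle_ineq]) (use t in \<open>simp add: norm_scaleC norm_mult\<close>)
  finally have tv: "t * norm v \<le> 1 / 2" by simp
  have "norm ((\<i> * t) *\<^sub>C v) < 1" using tv t by (simp add: norm_scaleC norm_mult)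
  then have "invertible_element (1 + (\<i> * t) *\<^sub>C v)"
    using invertible_one_minus [of "- ((\<i> * t) *\<^sub>C v)"] by simp
  then obtain w where w: "(1 + (\<i> * t) *\<^sub>C v) * w = 1" "w * (1 + (\<i> * t) *\<^sub>C v) = 1"
    by (auto simp: invertible_element_def)
  have "a = (1 + (\<i> * t) *\<^sub>C v) * u"
    using v(2) by (simp add: u_def algebra_simps mult_scaleC_left mult_scaleC_right scaleC_add_right)
  then have "a * (v * w) = (1 + (\<i> * t) *\<^sub>C v) * (u * v) * w" "v * w * a = v * (w * (1 + (\<i> * t) *\<^sub>C v)) * u"
    by (simp_all only: mult.assoc)
  then show ?thesis
    unfolding invertible_element_def by (intro exI [of _ "v * w"]) (simp add: v w)
qed


section \<open>The norm as a spectral value\<close>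

definition alg_inverse :: "'a::unital_cstar_algebra \<Rightarrow> 'a" where
  "alg_inverse a = (SOME b. a * b = 1 \<and> b * a = 1)"

lemma
  assumes "invertible_element a"
  shows right_alg_inverse: "a * alg_inverse a = 1"
    and left_alg_inverse: "alg_inverse a * a = 1"
  using someI_ex [OF assms [unfolded invertible_element_def]] by (simp_all add: alg_inverse_def)

lemma alg_inverse_eqI:
  assumes "a * b = 1" "b * a = 1"
  shows "alg_inverse a = b"
proof -
  have "invertible_element a" using assms by (auto simp: invertible_element_def)
  then have "alg_inverse a * (a * b) = b"
    by (simp add: left_alg_inverse flip: mult.assoc)
  with assms show ?thesis by simp
qed

lemma alg_inverse_diff:
  fixes a b :: "'a::unital_cstar_algebra"
  assumes "invertible_element a" "invertible_element b"
  shows "alg_inverse b - alg_inverse a = alg_inverse b * (a - b) * alg_inverse a"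
proof -
  have "alg_inverse b * (a - b) * alg_inverse a
      = alg_inverse b * (a * alg_inverse a) - (alg_inverse b * b) * alg_inverse a"
    by (simp add: algebra_simps)
  then show ?thesis by (simp add: assms left_alg_inverse right_alg_inverse)
qed

text \<open>By \<open>alg_inverse_diff\<close> it is enough to bound \<open>\<parallel>b\<^sup>-\<^sup>1\<parallel>\<close> for \<open>b\<close> near \<open>a\<close>. The same identity gives
  \<open>\<parallel>b\<^sup>-\<^sup>1\<parallel> \<le> \<parallel>a\<^sup>-\<^sup>1\<parallel> + \<parallel>b\<^sup>-\<^sup>1\<parallel> / 2\<close> once \<open>\<parallel>a - b\<parallel> \<parallel>a\<^sup>-\<^sup>1\<parallel> \<le> 1 / 2\<close>.\<close>

lemma continuous_on_alg_inverse: "continuous_on {a. invertible_element a} alg_inverse"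
proof (rule continuous_onI)
  fix a :: 'a and e :: real
  assume a: "a \<in> {a. invertible_element a}" and e: "e > 0"
  let ?i = "alg_inverse a"
  define N where "N = norm ?i + 1"
  have N: "N > 0" "norm ?i \<le> N" by (simp_all add: N_def add_nonneg_pos)
  define d where "d = min (1 / (2 * N)) (e / (2 * N\<^sup>2))"
  show "\<exists>d>0. \<forall>b\<in>{a. invertible_element a}. dist b a < d \<longrightarrow> dist (alg_inverse b) ?i \<le> e"
  proof (intro exI [of _ d] conjI ballI impI)
    show "d > 0" using N e by (simp add: d_def)
    fix b assume b: "b \<in> {a. invertible_element a}" and "dist b a < d"
    then have ab: "norm (a - b) \<le> d" by (simp add: dist_norm norm_minus_commute)
    let ?j = "alg_inverse b"
    have diff: "norm (?j - ?i) \<le> norm ?j * (d * N)"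
    proof -
      have "norm (?j - ?i) \<le> norm (?j * (a - b)) * norm ?i"
        using a b by (simp add: alg_inverse_diff norm_mult_ineq)
      also have "\<dots> \<le> (norm ?j * norm (a - b)) * norm ?i"
        by (intro mult_right_mono norm_mult_ineq) auto
      also have "\<dots> \<le> (norm ?j * d) * N"
        using ab N \<open>d > 0\<close> by (intro mult_mono) auto
      finally show ?thesis by (simp add: mult.assoc)
    qed
    have "d * N \<le> 1 / 2" using N by (simp add: d_def min_def field_simps)
    then have "norm ?j * (d * N) \<le> norm ?j * (1 / 2)" by (intro mult_left_mono) auto
    moreover have "norm ?j \<le> norm ?i + norm (?j - ?i)"
      by (metis add_diff_cancel_left' diff_add_cancel norm_triangle_sub)
    ultimately have "norm ?j \<le> 2 * N" using diff N(2) by linarith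
    then have "norm ?j * (d * N) \<le> (2 * N) * (d * N)"
      using N \<open>d > 0\<close> by (intro mult_right_mono) auto
    also have "\<dots> = d * (2 * N\<^sup>2)" by (simp add: power2_eq_square)
    also have "\<dots> \<le> (e / (2 * N\<^sup>2)) * (2 * N\<^sup>2)"
      by (intro mult_right_mono) (auto simp: d_def)
    also have "\<dots> = e" using N by simp
    finally show "dist ?j ?i \<le> e" using diff by (simp add: dist_norm)
  qed
qed

text \<open>The partial fraction decomposition \<open>1 / (1 - w\<^sup>2) = (1 / (1 - w) + 1 / (1 + w)) / 2\<close>.\<close>

lemma alg_inverse_one_minus_square:
  fixes w :: "'a::unital_cstar_algebra"
  assumes "invertible_element (1 - w)" "invertible_element (1 + w)"
  shows "invertible_element (1 - w * w)"
    and "alg_inverse (1 - w * w) = (1 / 2) *\<^sub>R (alg_inverse (1 - w) + alg_inverse (1 + w))"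
proof -
  let ?p = "alg_inverse (1 - w)" and ?q = "alg_inverse (1 + w)"
  define r where "r = (1 / 2) *\<^sub>R (?p + ?q)"
  have f: "1 - w * w = (1 + w) * (1 - w)" "1 - w * w = (1 - w) * (1 + w)"
    by (simp_all add: algebra_simps)
  have "(1 - w * w) * ?p = 1 + w" "?p * (1 - w * w) = 1 + w"
    using assms(1) by (simp add: f(1) mult.assoc right_alg_inverse)
      (simp add: f(2) left_alg_inverse [OF assms(1)] flip: mult.assoc)
  moreover have "(1 - w * w) * ?q = 1 - w" "?q * (1 - w * w) = 1 - w"
    using assms(2) by (simp add: f(2) mult.assoc right_alg_inverse)
      (simp add: f(1) left_alg_inverse [OF assms(2)] flip: mult.assoc)
  ultimately have "(1 - w * w) * r = 1" "r * (1 - w * w) = 1"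
    unfolding r_def using scaleR_half_double [of "1::'a"]
    by (simp_all add: distrib_left distrib_right)
  then show "invertible_element (1 - w * w)" "alg_inverse (1 - w * w) = r"
    by (auto simp: invertible_element_def intro: alg_inverse_eqI)
qed

text \<open>This replaces the spectral radius formula. By uniform continuity on the closed disc, there is
  \<open>s < 1\<close> such that the inverses of \<open>1 - \<mu> h\<close> and \<open>1 - s \<mu> h\<close> differ by at most \<open>1 / 8\<close> for all \<open>\<mu>\<close>
  on the unit circle. By \<open>alg_inverse_one_minus_square\<close>, the inverse of \<open>1 - \<nu>\<^sup>2 h\<^sup>2\<close> is the average of
  those of \<open>1 - \<nu> h\<close> and \<open>1 + \<nu> h\<close>, and \<open>- \<nu>\<close> is again on the circle. So the same bound, with the
  same constant, passes to \<open>h\<^sup>2\<close> and \<open>s\<^sup>2\<close>, and by iteration to \<open>h ^ 2 ^ k\<close> and \<open>s ^ 2 ^ k\<close>. Once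
  \<open>s ^ 2 ^ k\<close> is small, the inverse of \<open>1 - s ^ 2 ^ k h ^ 2 ^ k\<close> is near \<open>1\<close>; then so is the inverse
  of \<open>1 - h ^ 2 ^ k\<close>, which makes \<open>h ^ 2 ^ k\<close> small.\<close>

lemma norm_power_of_two_lt_1:
  fixes h :: "'a::unital_cstar_algebra"
  assumes inv: "\<And>\<mu>. cmod \<mu> \<le> 1 \<Longrightarrow> invertible_element (1 - \<mu> *\<^sub>C h)" and h: "norm h \<le> 1"
  obtains k where "norm (h ^ 2 ^ k) < 1"
proof -
  define g where "g \<mu> = alg_inverse (1 - \<mu> *\<^sub>C h)" for \<mu>
  have "continuous_on (cball 0 1) (\<lambda>\<mu>. 1 - \<mu> *\<^sub>C h)"
  proof (rule continuous_onI)
    fix \<mu> :: complex and \<epsilon> :: real assume "\<epsilon> > 0"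
    have "dist (1 - \<nu> *\<^sub>C h) (1 - \<mu> *\<^sub>C h) \<le> dist \<nu> \<mu>" for \<nu>
    proof -
      have "dist (1 - \<nu> *\<^sub>C h) (1 - \<mu> *\<^sub>C h) = norm ((\<mu> - \<nu>) *\<^sub>C h)"
        by (simp add: dist_norm scaleC_diff_left)
      also have "\<dots> \<le> dist \<nu> \<mu>"
        using h by (simp add: norm_scaleC dist_norm norm_minus_commute mult_left_le)
      finally show ?thesis .
    qed
    with \<open>\<epsilon> > 0\<close> show "\<exists>d>0. \<forall>\<nu>\<in>cball 0 1. dist \<nu> \<mu> < d \<longrightarrow> dist (1 - \<nu> *\<^sub>C h) (1 - \<mu> *\<^sub>C h) \<le> \<epsilon>"
      by (intro exI [of _ \<epsilon>]) (meson less_imp_le order_trans)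
  qed
  then have "continuous_on (cball 0 1) g"
    unfolding g_def using inv
    by (intro continuous_on_compose2 [OF continuous_on_alg_inverse]) auto
  then have "uniformly_continuous_on (cball 0 1) g"
    by (simp add: compact_uniformly_continuous)
  then obtain d where d: "d > 0"
    and g: "\<And>\<mu> \<nu>. \<lbrakk>\<mu> \<in> cball 0 1; \<nu> \<in> cball 0 1; dist \<nu> \<mu> < d\<rbrakk> \<Longrightarrow> dist (g \<nu>) (g \<mu>) < 1 / 8"
    unfolding uniformly_continuous_on_def by (metis zero_less_divide_1_iff zero_less_numeral)
  define s where "s = 1 - min d 1 / 2"
  have s: "0 < s" "s < 1" "1 - s < d" using d by (auto simp: s_def min_def)
  define close where "close u \<sigma> \<longleftrightarrow> (\<forall>\<mu>::complex. cmod \<mu> = 1 \<longrightarrow>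
      invertible_element (1 - \<mu> *\<^sub>C u) \<and> invertible_element (1 - (\<sigma> * \<mu>) *\<^sub>C u) \<and>
      norm (alg_inverse (1 - \<mu> *\<^sub>C u) - alg_inverse (1 - (\<sigma> * \<mu>) *\<^sub>C u)) \<le> 1 / 8)"
    for u :: 'a and \<sigma> :: real
  have close: "close (h ^ 2 ^ k) (s ^ 2 ^ k)" for k
  proof (induction k)
    case 0
    have "invertible_element (1 - \<mu> *\<^sub>C h) \<and> invertible_element (1 - (s * \<mu>) *\<^sub>C h) \<and>
        norm (alg_inverse (1 - \<mu> *\<^sub>C h) - alg_inverse (1 - (s * \<mu>) *\<^sub>C h)) \<le> 1 / 8"
      if \<mu>: "cmod \<mu> = 1" for \<mu> :: complex
    proof -
      from \<mu> have "dist \<mu> (s * \<mu>) = cmod ((1 - s) * \<mu>)"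
        by (simp add: dist_norm algebra_simps)
      also have "\<dots> < d" using s by (simp only: norm_mult norm_of_real \<mu>) simp
      finally have "dist (g \<mu>) (g (s * \<mu>)) < 1 / 8"
        using \<mu> s by (intro g) (auto simp: norm_mult)
      with \<mu> s show ?thesis
        by (auto simp: g_def dist_norm norm_mult intro!: inv)
    qed
    then show ?case by (simp add: close_def)
  next
    case (Suc k)
    define u \<sigma> where "u = h ^ 2 ^ k" and "\<sigma> = s ^ 2 ^ k"
    have "close (u * u) (\<sigma> * \<sigma>)"
      unfolding close_def
    proof (intro allI impI)
      fix \<mu> :: complex assume "cmod \<mu> = 1"
      define \<nu> where "\<nu> = csqrt \<mu>"
      have \<nu>: "\<mu> = \<nu> * \<nu>" by (metis \<nu>_def power2_csqrt power2_eq_square)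
      have \<nu>1: "cmod \<nu> = 1" using \<open>cmod \<mu> = 1\<close> by (simp add: \<nu>_def)
      define v w where "v = \<nu> *\<^sub>C u" and "w = (\<sigma> * \<nu>) *\<^sub>C u"
      have vv: "\<mu> *\<^sub>C (u * u) = v * v" "(complex_of_real (\<sigma> * \<sigma>) * \<mu>) *\<^sub>C (u * u) = w * w"
        by (simp_all add: v_def w_def \<nu> mult_scaleC_left mult_scaleC_right scaleC_scaleC mult_ac)
      have *: "invertible_element (1 - v)" "invertible_element (1 - w)"
          "norm (alg_inverse (1 - v) - alg_inverse (1 - w)) \<le> 1 / 8"
        using Suc \<nu>1 unfolding close_def u_def [symmetric] \<sigma>_def [symmetric]
        by (auto simp: v_def w_def)
      have **: "invertible_element (1 + v)" "invertible_element (1 + w)"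
          "norm (alg_inverse (1 + v) - alg_inverse (1 + w)) \<le> 1 / 8"
        using Suc [unfolded close_def, rule_format, of "- \<nu>"] \<nu>1
        unfolding u_def [symmetric] \<sigma>_def [symmetric]
        by (auto simp: v_def w_def scaleC_minus_left)
      note sq = alg_inverse_one_minus_square [OF *(1) **(1)] alg_inverse_one_minus_square [OF *(2) **(2)]
      have "alg_inverse (1 - v * v) - alg_inverse (1 - w * w)
          = (1 / 2) *\<^sub>R ((alg_inverse (1 - v) - alg_inverse (1 - w)) + (alg_inverse (1 + v) - alg_inverse (1 + w)))"
        by (simp add: sq algebra_simps)
      also have "norm \<dots> \<le> 1 / 2 * (1 / 8 + 1 / 8)"
        using norm_triangle_mono [OF *(3) **(3)] by simp
      finally show "invertible_element (1 - \<mu> *\<^sub>C (u * u)) \<and>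
          invertible_element (1 - (complex_of_real (\<sigma> * \<sigma>) * \<mu>) *\<^sub>C (u * u)) \<and>
          norm (alg_inverse (1 - \<mu> *\<^sub>C (u * u))
            - alg_inverse (1 - (complex_of_real (\<sigma> * \<sigma>) * \<mu>) *\<^sub>C (u * u))) \<le> 1 / 8"
        unfolding vv using sq(1,3) by simp
    qed
    then show ?case by (simp add: u_def \<sigma>_def power_add [symmetric] mult_2)
  qed
  obtain k where "s ^ k < 1 / 8" using s real_arch_pow_inv [of "1 / 8" s] by auto
  moreover have "s ^ 2 ^ k \<le> s ^ k" using s by (intro power_decreasing) auto
  ultimately have sk: "s ^ 2 ^ k < 1 / 8" by linarith
  define u \<sigma> where "u = h ^ 2 ^ k" and "\<sigma> = s ^ 2 ^ k"
  define p q where "p = alg_inverse (1 - u)" and "q = alg_inverse (1 - \<sigma> *\<^sub>R u)"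
  have invs: "invertible_element (1 - u)" "invertible_element (1 - \<sigma> *\<^sub>R u)" and pq: "norm (p - q) \<le> 1 / 8"
    using close [of k, unfolded close_def, rule_format, of 1]
    by (simp_all add: u_def \<sigma>_def p_def q_def scaleC_one scaleR_scaleC)
  have "norm u \<le> 1"
    using norm_power_ineq [of h "2 ^ k"] power_le_one [of "norm h" "2 ^ k"] h by (simp add: u_def)
  then have "norm (\<sigma> *\<^sub>R u) \<le> 1 / 8 * 1"
    unfolding norm_scaleR using sk s by (intro mult_mono) (auto simp: \<sigma>_def)
  then have "norm (q * \<sigma> *\<^sub>R u) \<le> norm q * (1 / 8)"
    by (intro order_trans [OF norm_mult_ineq] mult_left_mono) auto
  moreover have q: "q = 1 + q * \<sigma> *\<^sub>R u"
    using left_alg_inverse [OF invs(2)] by (simp add: q_def [symmetric] algebra_simps)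
  then have "norm q \<le> 1 + norm (q * \<sigma> *\<^sub>R u)" "norm (q - 1) = norm (q * \<sigma> *\<^sub>R u)"
    by (metis norm_one norm_triangle_ineq) (metis q add_diff_cancel_left')
  ultimately have "norm (q - 1) \<le> 1 / 7" by linarith
  then have p1: "norm (p - 1) \<le> 1 / 3"
    using pq norm_triangle_ineq [of "p - q" "q - 1"] by simp
  have "u = (p - 1) - (p - 1) * u"
    using left_alg_inverse [OF invs(1)] by (simp add: p_def [symmetric] algebra_simps)
  then have "norm u \<le> norm (p - 1) + norm ((p - 1) * u)"
    by (metis norm_triangle_ineq4)
  also have "\<dots> \<le> 1 / 3 + 1 / 3 * norm u"
    by (intro add_mono p1 order_trans [OF norm_mult_ineq] mult_right_mono) auto
  finally have "norm u < 1" by simp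
  then show ?thesis using that by (simp add: u_def)
qed


lemma adj_power: "adj a = a \<Longrightarrow> adj (a ^ n) = (a::'a::unital_cstar_algebra) ^ n"
  by (induction n) (simp_all add: adj_mult power_commutes)

lemma norm_power_of_two_self_adjoint:
  fixes a :: "'a::unital_cstar_algebra"
  assumes "adj a = a"
  shows "norm (a ^ 2 ^ k) = norm a ^ 2 ^ k"
proof (induction k)
  case (Suc k)
  have "norm (a ^ 2 ^ Suc k) = (norm (a ^ 2 ^ k))\<^sup>2"
    using norm_square_self_adjoint [OF adj_power [OF assms]]
    by (simp add: mult_2 power_add)
  with Suc show ?case by (simp add: mult.commute flip: power_mult)
qed simp

text \<open>Rescale \<open>a\<close> to \<open>h\<close> with \<open>\<parallel>h\<parallel> = 1\<close>. If neither \<open>\<parallel>a\<parallel>\<close> nor \<open>- \<parallel>a\<parallel>\<close> is in the spectrum, then no \<open>z\<close>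
  with \<open>|z| \<ge> \<parallel>a\<parallel>\<close> is, as the spectrum is real and lies in the disc of radius \<open>\<parallel>a\<parallel>\<close>. So
  \<open>norm_power_of_two_lt_1\<close> applies to \<open>h\<close>; but by the \<open>C\<^sup>*\<close>-identity all \<open>h ^ 2 ^ k\<close> have norm \<open>1\<close>.\<close>

lemma self_adjoint_norm_in_spectrum:
  fixes a :: "'a::unital_cstar_algebra"
  assumes a: "adj a = a"
  obtains s :: real where "\<bar>s\<bar> = norm a" "of_real s \<in> spectrum a"
proof (cases "a = 0")
  case True
  then have "of_real 0 \<in> spectrum a" by (simp add: spectrum_def invertible_element_def)
  with True show ?thesis by (intro that [of 0]) auto
next
  case False
  define N where "N = norm a"
  have N: "N > 0" using False by (simp add: N_def)
  define h where "h = (1 / N) *\<^sub>R a"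
  have h: "norm h = 1" "adj h = h" using N a by (simp_all add: h_def adj_scaleR N_def)
  show ?thesis
  proof (rule ccontr)
    assume "\<not> thesis"
    with that have notin: "of_real s \<notin> spectrum a" if "\<bar>s\<bar> = N" for s
      using that by (auto simp: N_def)
    have "invertible_element (1 - \<mu> *\<^sub>C h)" if \<mu>: "cmod \<mu> \<le> 1" for \<mu>
    proof (cases "\<mu> = 0")
      case True
      then show ?thesis by (auto simp: invertible_element_def)
    next
      case nz: False
      define z where "z = N / \<mu>"
      have "z \<notin> spectrum a"
      proof
        assume z: "z \<in> spectrum a"
        then have "Im z = 0" by (rule self_adjoint_spectrum_real [OF a])
        then have real: "z = of_real (Re z)" "cmod z = \<bar>Re z\<bar>"
          by (simp_all add: complex_eq_iff cmod_eq_Re)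
        have "N \<le> cmod z" using \<mu> nz N by (simp add: z_def norm_divide field_simps)
        with spectrum_norm_le [OF z] have "\<bar>Re z\<bar> = N" by (simp add: real(2) N_def)
        with notin [of "Re z"] z real(1) show False by metis
      qed
      moreover have "1 - \<mu> *\<^sub>C h = (- \<mu> / N) *\<^sub>C (a - z *\<^sub>C 1)"
        using nz N by (simp add: h_def z_def scaleC_diff_right scaleC_scaleC scaleR_scaleC
            scaleC_one scaleC_minus_left)
      ultimately show ?thesis using nz N
        by (simp only: invertible_scaleC_iff) (simp add: spectrum_def invertible_scaleC_iff)
    qed
    from norm_power_of_two_lt_1 [OF this] h obtain k where "norm (h ^ 2 ^ k) < 1" by auto
    with norm_power_of_two_self_adjoint [OF h(2)] h(1) show False by simp
  qed
qed

section \<open>Positive elements and their square roots\<close>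

lemma positive_norm_in_spectrum:
  assumes "positive_element a"
  shows "of_real (norm a) \<in> spectrum a"
proof -
  obtain s where s: "\<bar>s\<bar> = norm a" "of_real s \<in> spectrum a"
    using self_adjoint_norm_in_spectrum assms by (metis positive_element_def)
  with assms have "s \<ge> 0" by (auto simp: positive_element_def)
  with s show ?thesis by simp
qed

text \<open>The norm of \<open>\<parallel>a\<parallel> - a\<close> is attained at a spectral value \<open>\<parallel>a\<parallel> - l\<close> with \<open>l\<close> in the spectrum of \<open>a\<close>. In
  particular this norm is at most \<open>\<parallel>a\<parallel>\<close>, and strictly smaller when \<open>a\<close> is invertible, for then
  \<open>l \<noteq> 0\<close>.\<close>

lemma positive_norm_diff:
  fixes a :: "'a::unital_cstar_algebra"
  assumes a: "positive_element a"
  obtains l :: real where "0 \<le> l" "of_real l \<in> spectrum a" "norm (norm a *\<^sub>R 1 - a) = norm a - l"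
proof -
  define h where "h = norm a *\<^sub>R 1 - a"
  have "adj h = h" using a by (simp add: h_def adj_diff adj_scaleR positive_element_def)
  then obtain s where s: "\<bar>s\<bar> = norm h" "of_real s \<in> spectrum h"
    by (rule self_adjoint_norm_in_spectrum)
  define l where "l = norm a - s"
  have "h - of_real s *\<^sub>C 1 = - (a - of_real l *\<^sub>C 1)"
    by (simp add: h_def l_def scaleR_scaleC scaleC_diff_left)
  with s(2) have l: "of_real l \<in> spectrum a"
    by (simp only: spectrum_def mem_Collect_eq invertible_minus_iff not_False_eq_True)
  with a have "0 \<le> l" by (auto simp: positive_element_def)
  moreover have "l \<le> norm a" using spectrum_norm_le [OF l] by simp
  ultimately show ?thesis using l s(1) by (intro that [of l]) (simp_all add: h_def l_def)
qed

text \<open>The spectrum of \<open>a\<close> is real and lies within distance \<open>t\<close> of \<open>t\<close>.\<close>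

lemma positive_elementI:
  fixes a :: "'a::unital_cstar_algebra"
  assumes a: "adj a = a" and le: "norm (t *\<^sub>R 1 - a) \<le> t"
  shows "positive_element a"
proof -
  have "\<mu> \<in> complex_of_real ` {0..}" if \<mu>: "\<mu> \<in> spectrum a" for \<mu>
  proof -
    have "t *\<^sub>R 1 - a - (t - \<mu>) *\<^sub>C 1 = - (a - \<mu> *\<^sub>C 1)"
      by (simp add: scaleR_scaleC scaleC_diff_left)
    with \<mu> have "t - \<mu> \<in> spectrum (t *\<^sub>R 1 - a)"
      by (simp only: spectrum_def mem_Collect_eq invertible_minus_iff not_False_eq_True)
    with le have "cmod (t - \<mu>) \<le> t" using spectrum_norm_le order_trans by blast
    then have "t - Re \<mu> \<le> t" using complex_Re_le_cmod [of "t - \<mu>"] by simp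
    moreover have "\<mu> = of_real (Re \<mu>)"
      using self_adjoint_spectrum_real [OF a \<mu>] by (simp add: complex_eq_iff)
    ultimately show ?thesis by auto
  qed
  with a show ?thesis by (auto simp: positive_element_def)
qed

text \<open>The solution is \<open>s = 1 - (1 - k)\<^sup>1\<^sup>/\<^sup>2\<close>, the limit of the iteration
  \<open>f (n + 1) = (k + (f n)\<^sup>2) / 2\<close> from \<open>0\<close>. For \<open>\<parallel>k\<parallel> = 1\<close> the iteration need not be a
  contraction. It converges nevertheless: no step of \<open>f\<close> is longer than the corresponding step of
  the scalar sequence \<open>\<phi>\<close> of the case \<open>k = 1\<close>, which is increasing and bounded by \<open>1\<close>.\<close>

lemma square_fixed_point_exists:
  fixes k :: "'a::unital_cstar_algebra"
  assumes k: "adj k = k" "norm k \<le> 1"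
  obtains s where "adj s = s" "norm s \<le> 1" "s = (1 / 2) *\<^sub>R (k + s * s)"
proof -
  define f where "f = rec_nat (0::'a) (\<lambda>_ s. (1 / 2) *\<^sub>R (k + s * s))"
  define \<phi> where "\<phi> = rec_nat (0::real) (\<lambda>_ s. (1 / 2) * (1 + s * s))"
  have f [simp]: "f 0 = 0" "f (Suc n) = (1 / 2) *\<^sub>R (k + f n * f n)" for n by (simp_all add: f_def)
  have \<phi> [simp]: "\<phi> 0 = 0" "\<phi> (Suc n) = (1 / 2) * (1 + \<phi> n * \<phi> n)" for n by (simp_all add: \<phi>_def)
  have adj: "adj (f n) = f n" for n
    by (induction n) (simp_all add: adj_scaleR adj_add adj_mult k)
  have \<phi>01: "0 \<le> \<phi> n \<and> \<phi> n \<le> 1" for n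
  proof (induction n)
    case (Suc n)
    then have "\<phi> n * \<phi> n \<le> 1" by (intro mult_le_one) auto
    then show ?case by simp
  qed simp
  have f\<phi>: "norm (f n) \<le> \<phi> n" for n
  proof (induction n)
    case (Suc n)
    then have "norm (f n * f n) \<le> \<phi> n * \<phi> n"
      by (intro order_trans [OF norm_mult_ineq] mult_mono) (use \<phi>01 in auto)
    then show ?case using norm_triangle_ineq [of k "f n * f n"] k by simp
  qed simp
  have step: "norm (f (Suc n) - f n) \<le> \<phi> (Suc n) - \<phi> n" for n
  proof (induction n)
    case 0
    show ?case using k by simp
  next
    case (Suc n)
    let ?p = "f (Suc n)" and ?q = "f n" and ?\<pi> = "\<phi> (Suc n)" and ?\<rho> = "\<phi> n"
    have "norm (?p + ?q) \<le> ?\<pi> + ?\<rho>" using norm_triangle_mono f\<phi> by blast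
    then have le: "norm ((?p - ?q) * (?p + ?q)) \<le> (?\<pi> - ?\<rho>) * (?\<pi> + ?\<rho>)"
      "norm ((?p + ?q) * (?p - ?q)) \<le> (?\<pi> + ?\<rho>) * (?\<pi> - ?\<rho>)"
      using Suc \<phi>01
      by (auto intro!: order_trans [OF norm_mult_ineq] mult_mono simp del: f(2) \<phi>(2)
          intro: order_trans [OF norm_ge_zero])
    \<comment> \<open>The symmetrized product factors \<open>p\<^sup>2 - q\<^sup>2\<close> even when \<open>p\<close> and \<open>q\<close> do not commute.\<close>
    have "f (Suc (Suc n)) - ?p = (1 / 4) *\<^sub>R ((?p - ?q) * (?p + ?q) + (?p + ?q) * (?p - ?q))"
    proof -
      have "(?p - ?q) * (?p + ?q) + (?p + ?q) * (?p - ?q) = 2 *\<^sub>R (?p * ?p - ?q * ?q)"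
        by (simp add: algebra_simps scaleR_2 del: f(2))
      moreover have "f (Suc (Suc n)) - ?p = (1 / 2) *\<^sub>R (?p * ?p - ?q * ?q)"
        unfolding f(2) [of "Suc n"] by (subst (3) f(2)) (simp add: algebra_simps del: f(2))
      ultimately show ?thesis by simp
    qed
    also have "norm \<dots> \<le> (1 / 4) * ((?\<pi> - ?\<rho>) * (?\<pi> + ?\<rho>) + (?\<pi> + ?\<rho>) * (?\<pi> - ?\<rho>))"
      using norm_triangle_mono [OF le] by (simp del: f(2) \<phi>(2))
    also have "\<dots> = \<phi> (Suc (Suc n)) - ?\<pi>"
      unfolding \<phi>(2) [of "Suc n"] by (subst (6) \<phi>(2)) (simp add: field_simps del: \<phi>(2))
    finally show ?case .
  qed
  have diff: "norm (f (n + m) - f n) \<le> \<phi> (n + m) - \<phi> n" for n m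
  proof (induction m)
    case (Suc m)
    show ?case using norm_triangle_ineq [of "f (Suc (n + m)) - f (n + m)" "f (n + m) - f n"]
        step [of "n + m"] Suc by (simp del: f(2) \<phi>(2))
  qed simp
  have "incseq \<phi>" using step by (intro incseq_SucI) (meson diff_ge_0_iff_ge norm_ge_zero order_trans)
  then obtain L where "\<phi> \<longlonglongrightarrow> L"
    using incseq_convergent [of \<phi> 1] \<phi>01 by blast
  then have "Cauchy \<phi>" by (rule LIMSEQ_imp_Cauchy)
  have "Cauchy f"
  proof (rule metric_CauchyI)
    fix e :: real assume "e > 0"
    with \<open>Cauchy \<phi>\<close> obtain M where M: "\<And>m n. m \<ge> M \<Longrightarrow> n \<ge> M \<Longrightarrow> dist (\<phi> m) (\<phi> n) < e"
      by (meson metric_CauchyD)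
    have "dist (f m) (f n) < e" if "m \<ge> n" "n \<ge> M" for m n
      using diff [of n "m - n"] M [of m n] that by (simp add: dist_norm)
    then show "\<exists>M. \<forall>m\<ge>M. \<forall>n\<ge>M. dist (f m) (f n) < e"
      by (metis dist_commute nle_le)
  qed
  then obtain s where s: "f \<longlonglongrightarrow> s" by (auto simp: Cauchy_convergent_iff convergent_def)
  show ?thesis
  proof
    have "(\<lambda>n. f (Suc n)) \<longlonglongrightarrow> (1 / 2) *\<^sub>R (k + s * s)"
      unfolding f(2) by (intro tendsto_intros s)
    with LIMSEQ_Suc [OF s] show "s = (1 / 2) *\<^sub>R (k + s * s)" by (rule LIMSEQ_unique)
    show "norm s \<le> 1"
      using f\<phi> \<phi>01 by (intro LIMSEQ_le_const2 [OF tendsto_norm [OF s]]) (meson order_trans)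
    have "(\<lambda>n. adj (f n)) \<longlonglongrightarrow> adj s"
    proof (rule LIMSEQ_I)
      fix e :: real assume "e > 0"
      from LIMSEQ_D [OF s this] show "\<exists>N. \<forall>n\<ge>N. norm (adj (f n) - adj s) < e"
        by (simp flip: adj_diff)
    qed
    with s show "adj s = s" by (simp add: adj LIMSEQ_unique)
  qed
qed

text \<open>Rescaled by \<open>N = \<parallel>a\<parallel>\<close>, the element \<open>k = 1 - a / N\<close> has norm at most \<open>1\<close> by \<open>positive_norm_diff\<close>,
  and the fixed point \<open>s\<close> of \<open>square_fixed_point_exists\<close> satisfies \<open>(1 - s)\<^sup>2 = 1 - k = a / N\<close>.
  Positivity of \<open>1 - s\<close> comes from \<open>\<parallel>s\<parallel> \<le> 1\<close>.\<close>

lemma positive_square_root_exists: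
  fixes a :: "'a::unital_cstar_algebra"
  assumes a: "positive_element a"
  shows "\<exists>b. positive_element b \<and> b\<^sup>2 = a"
proof (cases "a = 0")
  case True
  with a show ?thesis by (intro exI [of _ 0]) simp
next
  case False
  define N where "N = norm a"
  have N: "N > 0" using False by (simp add: N_def)
  define k where "k = 1 - (1 / N) *\<^sub>R a"
  have "N *\<^sub>R k = N *\<^sub>R 1 - a" using N by (simp add: k_def algebra_simps)
  moreover obtain l where "0 \<le> l" "norm (N *\<^sub>R 1 - a) = N - l"
    using positive_norm_diff [OF a] by (metis N_def)
  ultimately have "norm (N *\<^sub>R k) \<le> N" by simp
  then have "norm k \<le> 1" using N by simp
  moreover have "adj k = k"
    using a by (simp add: k_def adj_diff adj_scaleR positive_element_def)
  ultimately obtain s where s: "adj s = s" "norm s \<le> 1" "s = (1 / 2) *\<^sub>R (k + s * s)"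
    using square_fixed_point_exists by blast
  define b where "b = sqrt N *\<^sub>R (1 - s)"
  have "2 *\<^sub>R s = k + s * s" using arg_cong [OF s(3), of "(*\<^sub>R) 2"] by simp
  moreover have "(1 - s) * (1 - s) = 1 - 2 *\<^sub>R s + s * s" by (simp add: algebra_simps scaleR_2)
  ultimately have "(1 - s) * (1 - s) = 1 - k" by simp
  then have "b\<^sup>2 = a" using N by (simp add: b_def power2_eq_square k_def)
  moreover have "positive_element b"
  proof (rule positive_elementI)
    show "adj b = b" by (simp add: b_def adj_scaleR adj_diff s(1))
    have "sqrt N *\<^sub>R 1 - b = sqrt N *\<^sub>R s" by (simp add: b_def algebra_simps)
    then show "norm (sqrt N *\<^sub>R 1 - b) \<le> sqrt N" using N s(2) by (simp add: mult_left_le)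
  qed
  ultimately show ?thesis by blast
qed

lemma positive_sqrt_square: "positive_element a \<Longrightarrow> (positive_sqrt a)\<^sup>2 = a"
  unfolding positive_sqrt_def using someI_ex [OF positive_square_root_exists] by blast


section \<open>Norm equality and invertibility in a Hilbert module\<close>

context hilbert_module
begin

lemma ip_add_left: "ip (x + y) z = ip x z + ip y z"
  using arg_cong [OF ip_add_right [of z x y], of adj] by (simp add: adj_ip adj_add)

lemma ip_scaleR_right: "ip x (r *\<^sub>R y) = r *\<^sub>R ip x y"
  by (simp add: scaleR_scaleC ip_scaleC_right)

lemma ip_scaleR_left: "ip (r *\<^sub>R x) y = r *\<^sub>R ip x y"
  using arg_cong [OF ip_scaleR_right [of y r x], of adj] by (simp add: adj_ip adj_scaleR)

lemma ip_diff_right: "ip x (y - z) = ip x y - ip x z"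
  using ip_add_right [of x "y - z" z] by simp

lemma ip_diff_left: "ip (x - y) z = ip x z - ip y z"
  using ip_add_left [of "x - y" y z] by simp

lemma ip_scaleC_left: "ip (\<alpha> *\<^sub>C x) y = cnj \<alpha> *\<^sub>C ip x y"
  using arg_cong [OF ip_scaleC_right [of y \<alpha> x], of adj] by (simp add: adj_ip adj_scaleC)

lemma ip_scaleC_unit:
  assumes "cmod \<mu> = 1"
  shows "ip (\<mu> *\<^sub>C y) (\<mu> *\<^sub>C y) = ip y y"
proof -
  have "ip (\<mu> *\<^sub>C y) (\<mu> *\<^sub>C y) = (\<mu> * cnj \<mu>) *\<^sub>C ip y y"
    by (simp add: ip_scaleC_left ip_scaleC_right scaleC_scaleC mult.commute)
  also have "\<mu> * cnj \<mu> = 1" using assms by (simp add: complex_norm_square [symmetric])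
  finally show ?thesis by (simp add: scaleC_one)
qed

lemma norm_square: "(norm x)\<^sup>2 = norm (ip x x)"
  by (simp add: norm_eq_sqrt_ip)

lemma ip_act_left: "ip (act x a) y = adj a * ip x y"
  using arg_cong [OF ip_act_right [of y x a], of adj] by (simp add: adj_ip adj_mult)

lemma ip_act_act: "ip (act x a) (act x a) = adj a * ip x x * a"
  by (simp add: ip_act_left ip_act_right mult.assoc)

lemma norm_act_le: "norm (act x a) \<le> norm x * norm a"
proof (rule power2_le_imp_le)
  have "norm (adj a * ip x x * a) \<le> norm (adj a * ip x x) * norm a" by (rule norm_mult_ineq)
  also have "\<dots> \<le> (norm (adj a) * norm (ip x x)) * norm a"
    by (intro mult_right_mono norm_mult_ineq) auto
  finally show "(norm (act x a))\<^sup>2 \<le> (norm x * norm a)\<^sup>2"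
    by (simp add: norm_square ip_act_act power_mult_distrib) (simp add: power2_eq_square mult_ac)
qed simp

text \<open>Here \<open>\<langle>v a, v a\<rangle> = a\<^sup>* a\<close>, so \<open>a \<mapsto> v a\<close> is an isometric embedding of the algebra.\<close>

lemma norm_act_unit: "ip v v = 1 \<Longrightarrow> norm (act v a) = norm a"
  by (simp add: norm_eq_sqrt_ip ip_act_act cstar_identity)

lemma act_diff_left: "act (x - y) a = act x a - act y a"
  using act_add_left [of "x - y" y a] by simp

lemma act_scaleR_left: "act (r *\<^sub>R x) a = r *\<^sub>R act x a"
  by (simp add: scaleR_scaleC act_scaleC_left)

lemma square_sqrt_ip: "(module_abs ip x)\<^sup>2 = ip x x"
  by (simp add: module_abs_def positive_sqrt_square ip_self_positive)

text \<open>For \<open>v = \<mu> y\<close> and \<open>r = \<parallel>x\<parallel>\<close> this recognises the element whose invertibility is in question as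
  the inner product of a vector with itself.\<close>

lemma ip_diff_scaleR_unit:
  assumes "ip v v = 1"
  shows "ip (x - r *\<^sub>R v) (x - r *\<^sub>R v) = ip x x - (2 * r) *\<^sub>R real_part (ip x v) + r\<^sup>2 *\<^sub>R 1"
proof -
  have "real_part (ip x v) = (1 / 2) *\<^sub>R (ip x v + ip v x)"
    by (simp add: real_part_def adj_ip scaleR_scaleC)
  then have "(2 * r) *\<^sub>R real_part (ip x v) = r *\<^sub>R (ip x v + ip v x)" by simp
  moreover have "ip (x - r *\<^sub>R v) (x - r *\<^sub>R v) = ip x x - r *\<^sub>R (ip x v + ip v x) + (r * r) *\<^sub>R 1"
    by (simp add: ip_diff_left ip_diff_right ip_scaleR_left ip_scaleR_right assms scaleR_right_distrib
        scaleR_right_diff_distrib)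
  ultimately show ?thesis by (simp only: power2_eq_square)
qed

text \<open>Were the norm smaller by \<open>\<delta>\<close>, the vector \<open>z c\<close> would make up for the missing length in
  \<open>(r + 1) v c = (x + v) c - z c\<close>, which gives \<open>\<parallel>z c\<parallel> \<ge> \<delta> \<parallel>c\<parallel>\<close>. As \<open>\<parallel>z c\<parallel>\<^sup>2 = \<parallel>c\<^sup>* \<langle>z, z\<rangle> c\<parallel>\<close>, the
  element \<open>\<langle>z, z\<rangle>\<close> would be bounded below and thus invertible.\<close>

lemma norm_add_unit_if_noninvertible:
  assumes v: "ip v v = 1" and z: "z = x - norm x *\<^sub>R v" and ninv: "\<not> invertible_element (ip z z)"
  shows "norm (x + v) = norm x + 1"
proof (rule ccontr)
  assume ne: "norm (x + v) \<noteq> norm x + 1"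
  define r where "r = norm x"
  define \<delta> where "\<delta> = r + 1 - norm (x + v)"
  have "norm v = 1" using v by (simp add: norm_eq_sqrt_ip)
  with ne norm_triangle_ineq [of x v] have \<delta>: "\<delta> > 0" by (simp add: \<delta>_def r_def)
  have below: "\<delta>\<^sup>2 * norm c \<le> norm (ip z z * c)" for c
  proof -
    have "(r + 1) *\<^sub>R act v c = act (x + v) c - act z c"
      by (simp add: z r_def act_add_left act_diff_left act_scaleR_left algebra_simps)
    then have "(r + 1) * norm c = norm (act (x + v) c - act z c)"
      by (metis abs_of_nonneg add_nonneg_nonneg norm_act_unit [OF v] norm_ge_zero norm_scaleR r_def
          zero_le_one)
    also have "\<dots> \<le> norm (x + v) * norm c + norm (act z c)"
      using norm_triangle_ineq4 [of "act (x + v) c" "act z c"] norm_act_le [of "x + v" c] by simp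
    finally have "\<delta> * norm c \<le> norm (act z c)" by (simp add: \<delta>_def algebra_simps)
    then have "(\<delta> * norm c)\<^sup>2 \<le> (norm (act z c))\<^sup>2" using \<delta> by (intro power_mono) auto
    also have "\<dots> = norm (adj c * (ip z z * c))" by (simp add: norm_square ip_act_act mult.assoc)
    also have "\<dots> \<le> norm c * norm (ip z z * c)"
      using norm_mult_ineq [of "adj c" "ip z z * c"] by simp
    finally have "norm c * (\<delta>\<^sup>2 * norm c) \<le> norm c * norm (ip z z * c)"
      by (simp add: power_mult_distrib power2_eq_square mult_ac)
    then show ?thesis by (cases "c = 0") auto
  qed
  have "invertible_element (ip z z)"
    using \<delta> by (intro self_adjoint_bounded_below_invertible [OF adj_ip _ below]) simp
  with ninv show False by contradiction
qed

text \<open>If \<open>b = \<langle>z, z\<rangle>\<close> is invertible, then \<open>\<parallel>b\<parallel> - b\<close> has norm less than \<open>\<parallel>b\<parallel>\<close> by \<open>positive_norm_diff\<close>,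
  while \<open>(r + 1) r\<^sup>2 - (r + 1) (r\<^sup>2 - \<langle>x, x\<rangle>) = (r + 1) \<langle>x, x\<rangle>\<close> has norm \<open>(r + 1) r\<^sup>2\<close>. Adding the two
  bounds, with \<open>M = \<parallel>b\<parallel> + (r + 1) r\<^sup>2\<close>, shows that \<open>b + (r + 1) (r\<^sup>2 - \<langle>x, x\<rangle>)\<close> is at distance less
  than \<open>M\<close> from \<open>M\<close>, hence invertible. But this element is \<open>r ((r + 1)\<^sup>2 - \<langle>x + v, x + v\<rangle>)\<close>, and
  \<open>(r + 1)\<^sup>2 = \<parallel>x + v\<parallel>\<^sup>2\<close> is a spectral value of \<open>\<langle>x + v, x + v\<rangle>\<close>.\<close>

lemma noninvertible_if_norm_add_unit:
  assumes v: "ip v v = 1" and z: "z = x - norm x *\<^sub>R v" and eq: "norm (x + v) = norm x + 1"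
  shows "\<not> invertible_element (ip z z)"
proof
  assume inv: "invertible_element (ip z z)"
  define r b a where "r = norm x" and "b = ip z z" and "a = ip (x + v) (x + v)"
  define M where "M = norm b + (r + 1) * r\<^sup>2"
  have "b \<noteq> 0" using inv by (auto simp: b_def invertible_element_def)
  \<comment> \<open>For \<open>x = 0\<close> also \<open>z = 0\<close>, so that \<open>b\<close> is not invertible.\<close>
  have r: "r > 0"
  proof -
    have "r \<noteq> 0" using \<open>b \<noteq> 0\<close> by (auto simp: b_def z r_def ip_self_eq_0_iff)
    then show ?thesis by (simp add: r_def)
  qed
  have na: "norm a = (r + 1)\<^sup>2" by (simp add: a_def r_def eq flip: norm_square)
  have identity: "r *\<^sub>R ((r + 1)\<^sup>2 *\<^sub>R 1 - a) = b + (r + 1) *\<^sub>R (r\<^sup>2 *\<^sub>R 1 - ip x x)"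
    by (simp add: a_def b_def z r_def [symmetric] ip_add_left ip_add_right ip_diff_left ip_diff_right
        ip_scaleR_left ip_scaleR_right v algebra_simps power2_eq_square)
      (simp flip: scaleR_left_distrib)
  obtain l where l: "0 \<le> l" "of_real l \<in> spectrum b" "norm (norm b *\<^sub>R 1 - b) = norm b - l"
    unfolding b_def by (rule positive_norm_diff [OF ip_self_positive])
  have "l \<noteq> 0" using l(2) inv by (auto simp: spectrum_def b_def)
  have "M *\<^sub>R 1 - r *\<^sub>R ((r + 1)\<^sup>2 *\<^sub>R 1 - a) = (norm b *\<^sub>R 1 - b) + (r + 1) *\<^sub>R ip x x"
    unfolding identity by (simp add: M_def algebra_simps)
  also have "norm \<dots> \<le> (norm b - l) + (r + 1) * r\<^sup>2"
    using norm_triangle_ineq [of "norm b *\<^sub>R 1 - b" "(r + 1) *\<^sub>R ip x x"] l(3) r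
    by (simp add: r_def norm_square)
  also have "\<dots> < M" using l(1) \<open>l \<noteq> 0\<close> by (simp add: M_def)
  finally have "norm (of_real M *\<^sub>C 1 - r *\<^sub>R ((r + 1)\<^sup>2 *\<^sub>R 1 - a)) < cmod (of_real M)"
    unfolding scaleR_scaleC [of M, symmetric] norm_of_real by linarith
  then have "invertible_element (r *\<^sub>R ((r + 1)\<^sup>2 *\<^sub>R 1 - a))" by (rule norm_less_imp_invertible)
  with r have "invertible_element (- (a - (r + 1)\<^sup>2 *\<^sub>R 1))" by (simp add: invertible_scaleR_iff)
  then have "of_real (norm a) \<notin> spectrum a"
    by (simp only: invertible_minus_iff spectrum_def na scaleR_scaleC mem_Collect_eq not_not)
  with positive_norm_in_spectrum [OF ip_self_positive] show False by (simp add: a_def)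
qed

end

theorem theorem2p10:
  fixes act :: "'x::complex_banach \<Rightarrow> 'a::unital_cstar_algebra \<Rightarrow> 'x"
    and ip :: "'x \<Rightarrow> 'x \<Rightarrow> 'a"
    and x y :: 'x
  assumes "hilbert_module act ip"
    and "(module_abs ip y)\<^sup>2 = 1"
  shows "x \<parallel> y \<longleftrightarrow>
    (\<exists>\<mu>. cmod \<mu> = 1 \<and>
      \<not> invertible_element
          ((module_abs ip x)\<^sup>2 - (2 * norm x) *\<^sub>R real_part (ip x (\<mu> *\<^sub>C y))
            + (norm x)\<^sup>2 *\<^sub>R 1))"
proof -
  interpret hilbert_module act ip by fact
  have y: "ip y y = 1" using assms(2) by (simp add: square_sqrt_ip)
  then have "norm y = 1" by (simp add: norm_eq_sqrt_ip)
  have "norm (x + \<mu> *\<^sub>C y) = norm x + norm y \<longleftrightarrow>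
      \<not> invertible_element
          ((module_abs ip x)\<^sup>2 - (2 * norm x) *\<^sub>R real_part (ip x (\<mu> *\<^sub>C y)) + (norm x)\<^sup>2 *\<^sub>R 1)"
    if "cmod \<mu> = 1" for \<mu>
  proof -
    have v: "ip (\<mu> *\<^sub>C y) (\<mu> *\<^sub>C y) = 1" using that y by (simp add: ip_scaleC_unit)
    show ?thesis
      unfolding square_sqrt_ip ip_diff_scaleR_unit [OF v, symmetric] \<open>norm y = 1\<close>
      using norm_add_unit_if_noninvertible [OF v refl] noninvertible_if_norm_add_unit [OF v refl]
      by blast
  qed
  then show ?thesis by (auto simp: norm_parallel_def)
qed

end
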